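(* Let $m\ge 2$, $n\ge 1$ be integers, let $T\ge 1$ be an integer, and let $A\colon \mathbb{N}^m\to\mathcal{M}_n(\mathbb{R})$ satisfy $A(t+T\cdot{\bf 1})=A(t)$ for all $t\in\mathbb{N}^m$ (i.e. the recurrence $x(t+{\bf 1})=A(t)x(t)$, $t\in\mathbb{N}^m$, is $T$-diagonal-periodic). Let $\Phi$ be the fundamental matrix of this recurrence, and define $$\widetilde{A}\colon\mathbb{N}^m\to\mathcal{M}_n(\mathbb{R}),\qquad \widetilde{A}(t)=\prod_{k=0}^{T-1}A\big(t+(T-1-k)\cdot{\bf 1}\big),\quad t\in\mathbb{N}^m .$$ Then, for every integer $k\ge 1$ and every $t\in\mathbb{N}^m$, $$\Phi\big(t+kT\cdot{\bf 1}\big)=\Phi(t)\Big(\widetilde{A}\big(t-\mu(t)\cdot{\bf 1}\big)\Big)^k .$$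
   Context: $\mathbb{N}=\{0,1,2,\ldots\}$; $\mathcal{M}_n(\mathbb{R})$ is the set of real $n\times n$ matrices. For $t=(t^1,\ldots,t^m)\in\mathbb{N}^m$, $\mu(t)=\min\{t^1,\ldots,t^m\}$, and ${\bf 1}=(1,1,\ldots,1)\in\mathbb{N}^m$. All matrix products are ordered with the index increasing from left to right: $\prod_{k=a}^{b}M_k=M_aM_{a+1}\cdots M_b$. Thus $\widetilde A(t)=A(t+(T-1)\cdot{\bf 1})A(t+(T-2)\cdot{\bf 1})\cdots A(t+{\bf 1})A(t)$. The fundamental matrix associated to the recurrence $x(t+{\bf 1})=A(t)x(t)$ is the function $\Phi\colon\mathbb{N}^m\to\mathcal{M}_n(\mathbb{R})$ defined by $\Phi(t)=\prod_{k=1}^{\mu(t)}A(t-k\cdot{\bf 1})=A(t-{\bf 1})A(t-2\cdot{\bf 1})\cdots A(t-\mu(t)\cdot{\bf 1})$ if $\mu(t)\ge 1$, and $\Phi(t)=I_n$ if $\mu(t)=0$. *)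

theory Defs
  imports "HOL-Analysis.Analysis"
begin

text \<open>
  Points of \<open>\<nat>\<^sup>m\<close> are vectors of type \<^typ>\<open>nat ^ 'm\<close>. The vector \<open>c \<cdot> (1, \<dots>, 1)\<close> is
  \<^term>\<open>diag c\<close>. Subtraction on \<^typ>\<open>nat ^ 'm\<close> is componentwise and truncated; below,
  \<^term>\<open>diag c\<close> is only ever subtracted from \<open>t\<close> with \<^prop>\<open>c \<le> min_coord t\<close> for
  \<open>min_coord\<close> the minimum of the coordinates of \<open>t\<close>, so that no truncation takes place.
\<close>

abbreviation diag :: "nat \<Rightarrow> nat ^ 'm" where
  "diag c \<equiv> c *s vec 1"

definition min_coord :: "nat ^ 'm \<Rightarrow> nat" where
  "min_coord t = Min (range (\<lambda>i. t $ i))"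

text \<open>
  Left-to-right product \<open>M a ** M (a + 1) ** \<dots> ** M b\<close>, which is the identity if \<open>b < a\<close>.
\<close>

definition mat_prod :: "nat \<Rightarrow> nat \<Rightarrow> (nat \<Rightarrow> real ^ 'n ^ 'n) \<Rightarrow> real ^ 'n ^ 'n" where
  "mat_prod a b M = foldr (**) (map M [a..<Suc b]) (mat 1)"

text \<open>
  Multiplication, and hence \<open>^\<close>, on \<^typ>\<open>real ^ 'n ^ 'n\<close> is entrywise in the library, so
  matrix powers are defined separately.
\<close>

primrec mat_power :: "real ^ 'n ^ 'n \<Rightarrow> nat \<Rightarrow> real ^ 'n ^ 'n" where
  "mat_power M 0 = mat 1"
| "mat_power M (Suc k) = M ** mat_power M k"

definition diagonal_periodic :: "nat \<Rightarrow> (nat ^ 'm \<Rightarrow> real ^ 'n ^ 'n) \<Rightarrow> bool" where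
  "diagonal_periodic T A \<longleftrightarrow> (\<forall>t. A (t + diag T) = A t)"

definition fundamental_matrix ::
    "(nat ^ 'm \<Rightarrow> real ^ 'n ^ 'n) \<Rightarrow> nat ^ 'm \<Rightarrow> real ^ 'n ^ 'n" where
  "fundamental_matrix A t =
     (if min_coord t \<ge> 1 then mat_prod 1 (min_coord t) (\<lambda>k. A (t - diag k)) else mat 1)"

text \<open>
  The matrix function \<open>A\<close> with a tilde,
  \<open>A (t + diag (T - 1)) ** \<dots> ** A (t + diag 1) ** A t\<close>. It is only meaningful
  for \<open>T \<ge> 1\<close>.
\<close>

definition monodromy ::
    "nat \<Rightarrow> (nat ^ 'm \<Rightarrow> real ^ 'n ^ 'n) \<Rightarrow> nat ^ 'm \<Rightarrow> real ^ 'n ^ 'n" where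
  "monodromy T A t = mat_prod 0 (T - 1) (\<lambda>k. A (t + diag (T - 1 - k)))"

end

theory Submission
  imports Defs
begin

text \<open>
  Along the diagonal \<open>s + diag j\<close> starting at a point \<open>s\<close> with minimal coordinate \<open>0\<close>, both
  \<open>\<Phi>\<close> and the monodromy matrix are iterated left multiplications of the sequence
  \<open>A (s + diag j)\<close>. Splitting the product of the first \<open>N + k T\<close> factors after the first \<open>k T\<close>, periodicity turns the left
  part into \<open>\<Phi>(t)\<close> and the right part into the \<open>k\<close>-th power of the first \<open>T\<close> factors.
\<close>

text \<open>New factors enter on the left, so a longer product keeps the shorter one as its right
  end.\<close>

primrec left_prod :: "(nat \<Rightarrow> real ^ 'n ^ 'n) \<Rightarrow> nat \<Rightarrow> real ^ 'n ^ 'n" where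
  "left_prod f 0 = mat 1"
| "left_prod f (Suc N) = f N ** left_prod f N"

lemma left_prod_add:
  "left_prod f (N + M) = left_prod (\<lambda>j. f (j + M)) N ** left_prod f M"
  by (induction N) (simp_all add: matrix_mul_assoc)

lemma left_prod_periodic_mult:
  assumes "\<And>j. f (j + T) = f j"
  shows "left_prod f (N + k * T) = left_prod f N ** mat_power (left_prod f T) k"
proof -
  have shift: "f (j + k * T) = f j" for j k
  proof (induction k)
    case (Suc k)
    then show ?case
      using assms[of "j + k * T"] by (simp add: algebra_simps)
  qed simp
  \<comment> \<open>Splitting \<open>T + k * T\<close> detaches the leftmost block of
    \<open>T\<close> factors, on the side where \<open>mat_power\<close> adds its factor.\<close>
  have "left_prod f (k * T) = mat_power (left_prod f T) k"
    by (induction k) (simp_all add: left_prod_add shift)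
  then show ?thesis
    by (simp add: left_prod_add shift)
qed

text \<open>The reversal \<open>k\<close> to \<open>b - k\<close> reconciles the two index orders.
  With \<open>b\<close> fixed and \<open>a\<close> moving down, the new leftmost factor
  \<open>M a\<close> is \<open>f N\<close>, as \<open>b - a = N\<close>.\<close>

lemma mat_prod_eq_left_prod:
  assumes "a + N = Suc b" and "\<And>k. a \<le> k \<Longrightarrow> k \<le> b \<Longrightarrow> M k = f (b - k)"
  shows "mat_prod a b M = left_prod f N"
  using assms
proof (induction N arbitrary: a)
  case 0
  then show ?case by (simp add: mat_prod_def)
next
  case (Suc N)
  have "mat_prod a b M = M a ** mat_prod (Suc a) b M"
    using Suc.prems(1) by (simp add: mat_prod_def upt_conv_Cons del: upt_Suc)
  moreover have "M a = f N"
  proof -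
    have "b - a = N" and "a \<le> b"
      using Suc.prems(1) by simp_all
    then show ?thesis
      using Suc.prems(2)[of a] by simp
  qed
  moreover have "mat_prod (Suc a) b M = left_prod f N"
    using Suc.prems by (intro Suc.IH) auto
  ultimately show ?case by simp
qed

text \<open>Adding \<open>c\<close> is monotone, hence commutes with the minimum.\<close>

lemma min_coord_add_diag: "min_coord (t + diag c) = min_coord t + c"
proof -
  have "range (\<lambda>i. (t + diag c) $ i) = (\<lambda>x. x + c) ` range (\<lambda>i. t $ i)"
    by (simp add: image_image)
  then show ?thesis
    unfolding min_coord_def
    by (simp add: mono_Min_commute[of "\<lambda>x. x + c", symmetric] mono_def)
qed

lemma fundamental_matrix_eq_left_prod:
  assumes "min_coord s = 0"
  shows "fundamental_matrix A (s + diag N) = left_prod (\<lambda>j. A (s + diag j)) N"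
proof -
  have "s + diag N - diag k = s + diag (N - k)" if "k \<le> N" for k
    using that by (simp add: vec_eq_iff)
  then have "mat_prod 1 N (\<lambda>k. A (s + diag N - diag k)) = left_prod (\<lambda>j. A (s + diag j)) N"
    by (intro mat_prod_eq_left_prod) auto
  moreover have "min_coord (s + diag N) = N"
    by (simp only: min_coord_add_diag assms add_0)
  ultimately show ?thesis
    \<comment> \<open>For \<open>N = 0\<close> both sides are the identity, by the other branch of
      the definition.\<close>
    by (cases N) (simp_all only: fundamental_matrix_def left_prod.simps, simp_all)
qed

text \<open>The factors run from 0 to \<open>T - 1\<close>; they number \<open>T\<close> because
  \<open>T \<ge> 1\<close>.\<close>

lemma monodromy_eq_left_prod:
  assumes "T \<ge> 1"
  shows "monodromy T A s = left_prod (\<lambda>j. A (s + diag j)) T"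
  unfolding monodromy_def using assms by (intro mat_prod_eq_left_prod) auto

lemma diag_add: "s + diag a + diag b = s + diag (a + b)"
  by (simp add: vec_eq_iff)

theorem proposition1:
  fixes A :: "nat ^ 'm \<Rightarrow> real ^ 'n ^ 'n"
    and T :: nat
  assumes "CARD('m) \<ge> 2"
    and "T \<ge> 1"
    and "diagonal_periodic T A"
  shows "\<forall>k::nat. k \<ge> 1 \<longrightarrow> (\<forall>t :: nat ^ 'm.
    fundamental_matrix A (t + diag (k * T)) =
      fundamental_matrix A t ** mat_power (monodromy T A (t - diag (min_coord t))) k)"
proof (intro allI impI)
  fix k :: nat and t :: "nat ^ 'm"
  define N where "N = min_coord t"
  define s where "s = t - diag N"
  let ?f = "\<lambda>j. A (s + diag j)"
  \<comment> \<open>This bound rules out truncation in \<open>t - diag N\<close>, so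
    \<open>t\<close> is recovered from \<open>s\<close>.\<close>
  have "N \<le> t $ i" for i
    unfolding N_def min_coord_def by (intro Min_le) auto
  then have t: "t = s + diag N"
    by (simp add: s_def vec_eq_iff)
  \<comment> \<open>Cancel \<open>N\<close> in \<open>min_coord s + N = N\<close>.\<close>
  have s: "min_coord s = 0"
    using min_coord_add_diag[of s N] unfolding t[symmetric] N_def[symmetric] by simp
  have periodic: "?f (j + T) = ?f j" for j
    using assms(3) unfolding diagonal_periodic_def diag_add[symmetric] by blast
  have "fundamental_matrix A (t + diag (k * T)) = left_prod ?f (N + k * T)"
    unfolding t diag_add by (rule fundamental_matrix_eq_left_prod[OF s])
  also have "\<dots> = left_prod ?f N ** mat_power (left_prod ?f T) k"
    by (rule left_prod_periodic_mult) (rule periodic)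
  also have "left_prod ?f N = fundamental_matrix A t"
    unfolding t by (rule fundamental_matrix_eq_left_prod[OF s, symmetric])
  also have "left_prod ?f T = monodromy T A s"
    by (rule monodromy_eq_left_prod[OF assms(2), symmetric])
  finally show "fundamental_matrix A (t + diag (k * T)) =
      fundamental_matrix A t ** mat_power (monodromy T A (t - diag (min_coord t))) k"
    unfolding s_def N_def .
qed

end
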